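(* For every $n\in\mathbb{Z}^+$, let $\mathbf u_n$ be the vector on $\Sigma^n$ with $(\mathbf u_n)_{\mathbf j}=\sqrt2\,(2\lambda_S M_f+\lambda_q)\,N^{-n}|I|$ for all $\mathbf j\in\Sigma^n$. Then for every $n\in\mathbb{Z}^+$ and every $k\in\mathbb{Z}^+$, \[ \underline{M}_n V(f,n,k-1)-N^k\mathbf u_n\;\le\;V(f,n,k)\;\le\;\overline{M}_n V(f,n,k-1)+N^k\mathbf u_n, \] where the inequalities between vectors are entrywise.
   Context: Grid. Let $N\ge 2$ be an integer, and let $x_0<x_1<\cdots<x_N$ and $y_0<y_1<\cdots<y_N$ be real numbers with $x_i-x_{i-1}=(x_N-x_0)/N$ and $y_i-y_{i-1}=(y_N-y_0)/N$ for $1\le i\le N$, and $x_N-x_0=y_N-y_0$. Put $I=[x_0,x_N]$, $J=[y_0,y_N]$, $|I|=x_N-x_0$, $D=I\times J$, $I_i=[x_{i-1},x_i]$, $J_j=[y_{j-1},y_j]$. For $1\le i\le N$ let $u_i:I\to I_i$ be the affine map with $u_i(x_0)=x_{i-1}$, $u_i(x_N)=x_i$ if $i$ is odd, and $u_i(x_0)=x_i$, $u_i(x_N)=x_{i-1}$ if $i$ is even; let $v_j:J\to J_j$ be the affine map with $v_j(y_0)=y_{j-1}$, $v_j(y_N)=y_j$ if $j$ is odd, and $v_j(y_0)=y_j$, $v_j(y_N)=y_{j-1}$ if $j$ is even. Let $\Sigma=\{1,\dots,N\}\times\{1,\dots,N\}$. For $w=(i,j)\in\Sigma$ let $D_w=I_i\times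 J_j$ and $L_w:D\to D_w$, $L_w(x,y)=(u_i(x),v_j(y))$. The function $f$. Let $z_{ij}\in\mathbb{R}$ ($0\le i,j\le N$) be given. Let $g,h,S:D\to\mathbb{R}$ be continuous with $g(x_i,y_j)=z_{ij}$ for $i,j\in\{0,N\}$, $h(x_i,y_j)=z_{ij}$ for all $0\le i,j\le N$, and $|S(x,y)|<1$ for all $(x,y)\in D$. Define $q:D\to\mathbb{R}$ by $q(x,y)=h(x,y)-S(x,y)\,g(L_w^{-1}(x,y))$ for $(x,y)\in D_w$, $w\in\Sigma$ (this is well defined and continuous). For $w=(i,j)\in\Sigma$ let $F_w(x,y,z)=S(L_w(x,y))\,z+q(L_w(x,y))$ and $\Psi_w(x,y,z)=(u_i(x),v_j(y),F_w(x,y,z))$ on $D\times\mathbb{R}$. It is known that there is a unique continuous $f:D\to\mathbb{R}$ with $f(x_i,y_j)=z_{ij}$ for all $0\le i,j\le N$ whose graph $\Gamma f=\{(x,y,f(x,y)):(x,y)\in D\}$ satisfies $\Gamma f=\bigcup_{w\in\Sigma}\Psi_w(\Gamma f)$; thus $f(x,y)=S(x,y)f(L_w^{-1}(x,y))+q(x,y)$ for $(x,y)\in D_w$. $S$ is called the vertical scaling function. Assume that $S$ and $q$ are Lipschitz on $D$: there are $\lambda_S,\lambda_q>0$ with $|S(t_1)-S(t_2)|\le\lambda_S|t_1-t_2|$ and $|q(t_1)-q(t_2)|\le\lambda_q|t_1-t_2|$ for all $t_1,t_2\in D$ (Euclidean norm); fix such constants. Put $M_f=\sup_{(x,y)\in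 D}|f(x,y)|$. Words. For $n\ge1$, $\Sigma^n$ is the set of words $\mathbf w=w_1\cdots w_n$ with letters in $\Sigma$; $\Sigma^0=\{\vartheta\}$ with $\vartheta$ the empty word. For $\mathbf w=w_1\cdots w_n\in\Sigma^n$, $n\ge1$, put $\sigma(\mathbf w)=w_2\cdots w_n\in\Sigma^{n-1}$, $L_{\mathbf w}=L_{w_1}\circ\cdots\circ L_{w_n}$, $D_{\mathbf w}=L_{\mathbf w}(D)$; $D_\vartheta=D$. Juxtaposition denotes concatenation. Oscillation vectors. For $E\subset D$ and $\varphi:D\to\mathbb{R}$ continuous, $O(\varphi,E)=\sup\{\varphi(\mathbf x')-\varphi(\mathbf x''):\mathbf x',\mathbf x''\in E\}$. For a finite word $\mathbf p$ and $k\ge0$, $O_k(\varphi,D_{\mathbf p})=\sum_{\mathbf w\in\Sigma^k}O(\varphi,D_{\mathbf p\mathbf w})$ (so $O_0(\varphi,D_{\mathbf p})=O(\varphi,D_{\mathbf p})$). $V(\varphi,n,k)$ is the vector on $\Sigma^n$ with entries $(V(\varphi,n,k))_{\mathbf j}=O_k(\varphi,D_{\mathbf j})$, $\mathbf j\in\Sigma^n$. Vertical scaling matrices. For a word $\mathbf w$ put $\overline s_{\mathbf w}=\sup_{t\in D_{\mathbf w}}|S(t)|$, $\underline s_{\mathbf w}=\inf_{t\in D_{\mathbf w}}|S(t)|$. For $n\ge1$, $\overline M_n$ is the $\Sigma^n\times\Sigma^n$ matrix with $(\overline M_n)_{\mathbf i,\mathbf j}=\overline s_{\mathbf i j_n}$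 if $\sigma(\mathbf i)=j_1\cdots j_{n-1}$ and $0$ otherwise, where $\mathbf i=i_1\cdots i_n$, $\mathbf j=j_1\cdots j_n$; $\underline M_n$ is defined in the same way with $\underline s_{\mathbf i j_n}$ in place of $\overline s_{\mathbf i j_n}$. *)

theory Defs
  imports "HOL-Analysis.Analysis"
begin

text \<open>
  Grids are maps \<open>x, y :: nat \<Rightarrow> real\<close> of which only the values at \<open>0, \<dots>, N\<close> matter. Points of the
  plane have type \<open>real \<times> real\<close>, whose library norm is the Euclidean one. Letters are pairs of
  indices and words are lists of letters. Vectors and matrices over a set of words are functions
  that are \<open>undefined\<close> off that set.
\<close>

definition rect :: "nat \<Rightarrow> (nat \<Rightarrow> real) \<Rightarrow> (nat \<Rightarrow> real) \<Rightarrow> (real \<times> real) set" where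
  "rect N x y = {x 0..x N} \<times> {y 0..y N}"

text \<open>
  The affine map of \<open>[x 0, x N]\<close> onto \<open>[x (i - 1), x i]\<close>, increasing for odd \<open>i\<close> and decreasing for
  even \<open>i\<close>. With the grid \<open>x\<close> it is the map $u_i$, with the grid \<open>y\<close> it is $v_i$.
\<close>

definition fold_map :: "nat \<Rightarrow> (nat \<Rightarrow> real) \<Rightarrow> nat \<Rightarrow> real \<Rightarrow> real" where
  "fold_map N x i t =
     (if odd i then x (i - 1) + (t - x 0) / (x N - x 0) * (x i - x (i - 1))
      else x i + (t - x 0) / (x N - x 0) * (x (i - 1) - x i))"

lemma fold_map_endpoints:
  assumes "x 0 < x N"
  shows "odd i \<Longrightarrow> fold_map N x i (x 0) = x (i - 1)" "odd i \<Longrightarrow> fold_map N x i (x N) = x i"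
    and "even i \<Longrightarrow> fold_map N x i (x 0) = x i" "even i \<Longrightarrow> fold_map N x i (x N) = x (i - 1)"
  using assms by (simp_all add: fold_map_def)

type_synonym letter = "nat \<times> nat"

definition letters :: "nat \<Rightarrow> letter set" where
  "letters N = {1..N} \<times> {1..N}"

definition words :: "nat \<Rightarrow> nat \<Rightarrow> letter list set" where
  "words N n = {w. length w = n \<and> set w \<subseteq> letters N}"

definition cell :: "(nat \<Rightarrow> real) \<Rightarrow> (nat \<Rightarrow> real) \<Rightarrow> letter \<Rightarrow> (real \<times> real) set" where
  "cell x y = (\<lambda>(i, j). {x (i - 1)..x i} \<times> {y (j - 1)..y j})"

definition letter_map ::
    "nat \<Rightarrow> (nat \<Rightarrow> real) \<Rightarrow> (nat \<Rightarrow> real) \<Rightarrow> letter \<Rightarrow> real \<times> real \<Rightarrow> real \<times> real" where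
  "letter_map N x y = (\<lambda>(i, j) (a, b). (fold_map N x i a, fold_map N y j b))"

primrec word_map ::
    "nat \<Rightarrow> (nat \<Rightarrow> real) \<Rightarrow> (nat \<Rightarrow> real) \<Rightarrow> letter list \<Rightarrow> real \<times> real \<Rightarrow> real \<times> real" where
  "word_map N x y [] = id"
| "word_map N x y (w # ws) = letter_map N x y w \<circ> word_map N x y ws"

definition word_cell ::
    "nat \<Rightarrow> (nat \<Rightarrow> real) \<Rightarrow> (nat \<Rightarrow> real) \<Rightarrow> letter list \<Rightarrow> (real \<times> real) set" where
  "word_cell N x y w = word_map N x y w ` rect N x y"

text \<open>The map $\Psi_w(a, b, c) = (L_w(a, b), S(L_w(a, b))\, c + q(L_w(a, b)))$.\<close>

definition ifs_map ::
    "nat \<Rightarrow> (nat \<Rightarrow> real) \<Rightarrow> (nat \<Rightarrow> real) \<Rightarrow> (real \<times> real \<Rightarrow> real) \<Rightarrow> (real \<times> real \<Rightarrow> real)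
      \<Rightarrow> letter \<Rightarrow> real \<times> real \<times> real \<Rightarrow> real \<times> real \<times> real" where
  "ifs_map N x y S q w = (\<lambda>(a, b, c).
     (fst (letter_map N x y w (a, b)), snd (letter_map N x y w (a, b)),
      S (letter_map N x y w (a, b)) * c + q (letter_map N x y w (a, b))))"

definition graph_over ::
    "(real \<times> real) set \<Rightarrow> (real \<times> real \<Rightarrow> real) \<Rightarrow> (real \<times> real \<times> real) set" where
  "graph_over E f = {(a, b, f (a, b)) | a b. (a, b) \<in> E}"

definition sup_abs :: "('a \<Rightarrow> real) \<Rightarrow> 'a set \<Rightarrow> real" where
  "sup_abs \<phi> E = (SUP t\<in>E. \<bar>\<phi> t\<bar>)"

definition inf_abs :: "('a \<Rightarrow> real) \<Rightarrow> 'a set \<Rightarrow> real" where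
  "inf_abs \<phi> E = (INF t\<in>E. \<bar>\<phi> t\<bar>)"

definition osc :: "('a \<Rightarrow> real) \<Rightarrow> 'a set \<Rightarrow> real" where
  "osc \<phi> E = Sup {\<phi> s - \<phi> t | s t. s \<in> E \<and> t \<in> E}"

definition osc_sum ::
    "nat \<Rightarrow> (nat \<Rightarrow> real) \<Rightarrow> (nat \<Rightarrow> real) \<Rightarrow> (real \<times> real \<Rightarrow> real) \<Rightarrow> nat \<Rightarrow> letter list \<Rightarrow> real" where
  "osc_sum N x y \<phi> k p = (\<Sum>w\<in>words N k. osc \<phi> (word_cell N x y (p @ w)))"

definition osc_vec ::
    "nat \<Rightarrow> (nat \<Rightarrow> real) \<Rightarrow> (nat \<Rightarrow> real) \<Rightarrow> (real \<times> real \<Rightarrow> real) \<Rightarrow> nat \<Rightarrow> nat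
      \<Rightarrow> letter list \<Rightarrow> real" where
  "osc_vec N x y \<phi> n k = (\<lambda>j\<in>words N n. osc_sum N x y \<phi> k j)"

text \<open>
  The matrix on $\Sigma^n$ ($n \ge 1$) whose entry at \<open>(i, j)\<close> is \<open>s\<close> of the word \<open>i\<close> extended by the
  last letter of \<open>j\<close>, provided that dropping the first letter of \<open>i\<close> and the last letter of \<open>j\<close>
  leaves the same word.
\<close>

definition shift_mat ::
    "nat \<Rightarrow> nat \<Rightarrow> (letter list \<Rightarrow> real) \<Rightarrow> letter list \<Rightarrow> letter list \<Rightarrow> real" where
  "shift_mat N n s = (\<lambda>i\<in>words N n. \<lambda>j\<in>words N n.
     if tl i = butlast j then s (i @ [last j]) else 0)"

definition upper_mat ::
    "nat \<Rightarrow> (nat \<Rightarrow> real) \<Rightarrow> (nat \<Rightarrow> real) \<Rightarrow> (real \<times> real \<Rightarrow> real) \<Rightarrow> nat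
      \<Rightarrow> letter list \<Rightarrow> letter list \<Rightarrow> real" where
  "upper_mat N x y S n = shift_mat N n (\<lambda>w. sup_abs S (word_cell N x y w))"

definition lower_mat ::
    "nat \<Rightarrow> (nat \<Rightarrow> real) \<Rightarrow> (nat \<Rightarrow> real) \<Rightarrow> (real \<times> real \<Rightarrow> real) \<Rightarrow> nat
      \<Rightarrow> letter list \<Rightarrow> letter list \<Rightarrow> real" where
  "lower_mat N x y S n = shift_mat N n (\<lambda>w. inf_abs S (word_cell N x y w))"

definition mat_vec :: "'a set \<Rightarrow> ('a \<Rightarrow> 'a \<Rightarrow> real) \<Rightarrow> ('a \<Rightarrow> real) \<Rightarrow> 'a \<Rightarrow> real" where
  "mat_vec A M v = (\<lambda>i\<in>A. \<Sum>j\<in>A. M i j * v j)"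

definition err_vec ::
    "nat \<Rightarrow> (nat \<Rightarrow> real) \<Rightarrow> (nat \<Rightarrow> real) \<Rightarrow> (real \<times> real \<Rightarrow> real) \<Rightarrow> real \<Rightarrow> real \<Rightarrow> nat
      \<Rightarrow> letter list \<Rightarrow> real" where
  "err_vec N x y f lam_S lam_q n = (\<lambda>j\<in>words N n.
     sqrt 2 * (2 * lam_S * sup_abs f (rect N x y) + lam_q) / real N ^ n * (x N - x 0))"

end

theory Submission
  imports Defs
begin

text \<open>
  Write \<open>L a\<close> for the map of a letter \<open>a\<close> and \<open>D v\<close> for the cell of a word \<open>v\<close>. Since the graph of
  \<open>f\<close> is invariant, \<open>f (L a s) = S (L a s) * f s + q (L a s)\<close> on the whole square, so for \<open>s, t\<close> in
  \<open>D v\<close>, with images \<open>s' = L a s\<close> and \<open>t' = L a t\<close> in \<open>D (a # v)\<close>,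
  \[ f(s') - f(t') = S(s')\,(f(s) - f(t)) + (S(s') - S(t'))\,f(t) + (q(s') - q(t')). \]
  The last two terms add up to at most \<open>(lam_S * M + lam_q) * diam (D (a # v))\<close> in absolute value,
  where \<open>M\<close> is the supremum of \<open>\<bar>f\<bar>\<close>, hence to at most \<open>(2 * lam_S * M + lam_q) * diam (D (a # v))\<close>.
  So the oscillation of \<open>f\<close> on \<open>D (a # v)\<close> is the oscillation on \<open>D v\<close> times a factor between the
  infimum and the supremum of \<open>\<bar>S\<bar>\<close> on \<open>D (a # v)\<close>, up to that error
  (\<open>osc_image_le\<close> and \<open>osc_image_ge\<close>).

  The steps of the grid are equal, so each \<open>L a\<close> is a similarity of ratio \<open>1 / N\<close>, and the diameter
  of \<open>D (a # v)\<close> is at most \<open>sqrt 2 * l / N ^ (n + k)\<close>, where \<open>l\<close> is the side of the square, when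
  \<open>a # v\<close> has length \<open>n + k\<close>. Now let \<open>a # v = i @ c # w\<close> run
  over the extensions of a word \<open>i\<close> of length \<open>n\<close> by a letter \<open>c\<close> and a word \<open>w\<close> of length \<open>k - 1\<close>. The
  supremum of \<open>\<bar>S\<bar>\<close> grows and the infimum shrinks when \<open>D (i @ c # w)\<close> is replaced by \<open>D (i @ [c])\<close>,
  which depends on \<open>c\<close> only. Summing over \<open>w\<close> turns the oscillations on the cells \<open>D (tl i @ c # w)\<close>
  into the entry of the oscillation vector at \<open>tl i @ [c]\<close>, and summing over \<open>c\<close> is exactly the
  multiplication of row \<open>i\<close> of the matrix with that vector (\<open>mat_vec_shift_mat\<close>). The \<open>N ^ (2 * k)\<close>
  extensions contribute \<open>N ^ (2 * k) / N ^ (n + k) = N ^ k / N ^ n\<close> times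
  \<open>(2 * lam_S * M + lam_q) * sqrt 2 * l\<close> to the error, which is the entry of the error vector times
  \<open>N ^ k\<close>.
\<close>

section \<open>Words\<close>

lemma finite_letters [simp]: "finite (letters N)"
  by (simp add: letters_def)

lemma finite_words [simp]: "finite (words N n)"
  using finite_lists_length_eq[OF finite_letters, of N n] by (simp add: words_def conj_commute)

lemma card_words: "card (words N n) = N ^ (2 * n)"
proof -
  have "card (words N n) = card (letters N) ^ n"
    using card_lists_length_eq[OF finite_letters, of N n] by (simp add: words_def conj_commute)
  also have "card (letters N) = N ^ 2"
    by (simp add: letters_def card_cartesian_product power2_eq_square)
  finally show ?thesis
    by (simp add: power_mult)
qed

lemma sum_words_Suc:
  "(\<Sum>w\<in>words N (Suc k). F w) = (\<Sum>c\<in>letters N. \<Sum>w\<in>words N k. F (c # w))"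
proof -
  have "bij_betw (\<lambda>(c, w). c # w) (letters N \<times> words N k) (words N (Suc k))"
    unfolding bij_betw_def inj_on_def
    by (auto simp: words_def length_Suc_conv image_iff)
  from sum.reindex_bij_betw[OF this, of F] show ?thesis
    by (simp add: sum.cartesian_product split_def)
qed

lemma osc_sum_Suc:
  "osc_sum N x y \<phi> (Suc k) p = (\<Sum>c\<in>letters N. osc_sum N x y \<phi> k (p @ [c]))"
  by (simp add: osc_sum_def sum_words_Suc)

text \<open>
  The only nonzero entries in row \<open>i\<close> stand in the columns \<open>tl i @ [c]\<close>.
\<close>

lemma mat_vec_shift_mat:
  assumes n: "n \<ge> 1" and i: "i \<in> words N n"
  shows "mat_vec (words N n) (shift_mat N n s) (osc_vec N x y \<phi> n k) i
           = (\<Sum>c\<in>letters N. s (i @ [c]) * osc_sum N x y \<phi> k (tl i @ [c]))"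
proof -
  let ?C = "(\<lambda>c. tl i @ [c]) ` letters N"
  have sub: "?C \<subseteq> words N n"
    using n i by (cases i) (auto simp: words_def)
  have row: "j \<in> ?C" if j: "j \<in> words N n" and "tl i = butlast j" for j
  proof -
    have "j \<noteq> []" using j n by (auto simp: words_def)
    then have "j = tl i @ [last j]" "last j \<in> letters N"
      using that by (auto simp: words_def dest: last_in_set)
    then show ?thesis by blast
  qed
  have "mat_vec (words N n) (shift_mat N n s) (osc_vec N x y \<phi> n k) i
          = (\<Sum>j\<in>words N n. if tl i = butlast j then s (i @ [last j]) * osc_sum N x y \<phi> k j else 0)"
    using i by (auto simp: mat_vec_def shift_mat_def osc_vec_def intro!: sum.cong)
  also have "\<dots> = (\<Sum>j\<in>?C. s (i @ [last j]) * osc_sum N x y \<phi> k j)"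
    using row by (intro sum.mono_neutral_cong_right sub) auto
  also have "\<dots> = (\<Sum>c\<in>letters N. s (i @ [c]) * osc_sum N x y \<phi> k (tl i @ [c]))"
    by (subst sum.reindex) (auto simp: inj_on_def)
  finally show ?thesis .
qed

section \<open>Cells\<close>

lemma dist_fold_map:
  assumes "x 0 < x N" and "x i - x (i - 1) = (x N - x 0) / real N"
  shows "dist (fold_map N x i s) (fold_map N x i t) = dist s t / real N"
proof -
  have "fold_map N x i s - fold_map N x i t
          = (if odd i then 1 else - 1) * ((s - t) / (x N - x 0) * (x i - x (i - 1)))"
    by (simp add: fold_map_def diff_divide_distrib algebra_simps)
  also have "\<dots> = (if odd i then 1 else - 1) * ((s - t) / real N)"
    using assms by simp
  finally show ?thesis
    by (simp add: dist_real_def abs_mult)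
qed

lemma dist_letter_map:
  assumes "x 0 < x N" and "y 0 < y N"
    and "\<And>i. i \<in> {1..N} \<Longrightarrow> x i - x (i - 1) = (x N - x 0) / real N"
    and "\<And>i. i \<in> {1..N} \<Longrightarrow> y i - y (i - 1) = (y N - y 0) / real N"
    and "w \<in> letters N"
  shows "dist (letter_map N x y w s) (letter_map N x y w t) = dist s t / real N"
proof -
  obtain i j where w: "w = (i, j)" "i \<in> {1..N}" "j \<in> {1..N}"
    using assms(5) by (auto simp: letters_def)
  obtain a b c d where st: "s = (a, b)" "t = (c, d)"
    by (cases s, cases t)
  have "dist (letter_map N x y w s) (letter_map N x y w t)
          = sqrt ((dist a c / real N)\<^sup>2 + (dist b d / real N)\<^sup>2)"
    using w assms(1,2,3,4)
    by (simp add: st letter_map_def dist_Pair_Pair dist_fold_map)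
  also have "\<dots> = sqrt ((dist a c)\<^sup>2 + (dist b d)\<^sup>2) / real N"
    by (simp add: power_divide real_sqrt_divide flip: add_divide_distrib)
  finally show ?thesis
    by (simp add: st dist_Pair_Pair)
qed

lemma dist_word_map:
  assumes "\<And>w s t. w \<in> letters N \<Longrightarrow>
             dist (letter_map N x y w s) (letter_map N x y w t) = dist s t / real N"
    and "set p \<subseteq> letters N"
  shows "dist (word_map N x y p s) (word_map N x y p t) = dist s t / real N ^ length p"
  using assms(2) by (induction p) (simp_all add: assms(1) mult.commute)

lemma dist_rect_le:
  assumes "x N - x 0 = y N - y 0" and "s \<in> rect N x y" and "t \<in> rect N x y"
  shows "dist s t \<le> sqrt 2 * (x N - x 0)"
proof -
  obtain a b c d where st: "s = (a, b)" "t = (c, d)"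
    by (cases s, cases t)
  have "\<bar>a - c\<bar> \<le> x N - x 0" "\<bar>b - d\<bar> \<le> x N - x 0"
    using assms by (auto simp: st rect_def abs_le_iff)
  then have "(a - c)\<^sup>2 \<le> (x N - x 0)\<^sup>2" "(b - d)\<^sup>2 \<le> (x N - x 0)\<^sup>2"
    by (metis abs_ge_zero power2_abs power_mono)+
  then have "dist s t \<le> sqrt (2 * (x N - x 0)\<^sup>2)"
    by (simp add: st dist_Pair_Pair dist_real_def)
  also have "\<dots> = sqrt 2 * (x N - x 0)"
    using \<open>\<bar>a - c\<bar> \<le> x N - x 0\<close> by (simp add: real_sqrt_mult)
  finally show ?thesis .
qed

lemma word_cell_Cons: "word_cell N x y (a # v) = letter_map N x y a ` word_cell N x y v"
  by (simp add: word_cell_def image_comp)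

lemma word_map_append: "word_map N x y (u @ v) = word_map N x y u \<circ> word_map N x y v"
  by (induction u) (simp_all add: comp_assoc)

lemma word_cell_subset_rect:
  assumes "\<And>w. w \<in> letters N \<Longrightarrow> letter_map N x y w ` rect N x y \<subseteq> rect N x y"
    and "set v \<subseteq> letters N"
  shows "word_cell N x y v \<subseteq> rect N x y"
  using assms(2)
proof (induction v)
  case Nil
  then show ?case by (simp add: word_cell_def)
next
  case (Cons a v)
  then show ?case
    using assms(1)[of a] unfolding word_cell_Cons by fastforce
qed

lemma word_cell_append_subset:
  assumes "\<And>w. w \<in> letters N \<Longrightarrow> letter_map N x y w ` rect N x y \<subseteq> rect N x y"
    and "set v \<subseteq> letters N"
  shows "word_cell N x y (u @ v) \<subseteq> word_cell N x y u"
  using word_cell_subset_rect[OF assms]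
  by (auto simp: word_cell_def word_map_append)

section \<open>The functional equation\<close>

text \<open>
  A graph has one point above each \<open>t\<close>, so a graph that contains its image under an \<open>ifs_map\<close> yields
  both that the square is mapped into itself and the value of \<open>f\<close> at the image point.
\<close>

lemma graph_invariant_eq:
  assumes "ifs_map N x y S q w ` graph_over D f \<subseteq> graph_over D f" and "t \<in> D"
  shows "letter_map N x y w t \<in> D"
    and "f (letter_map N x y w t)
           = S (letter_map N x y w t) * f t + q (letter_map N x y w t)"
proof -
  obtain a b where t: "t = (a, b)" by (cases t)
  have "(a, b, f (a, b)) \<in> graph_over D f"
    using assms(2) by (auto simp: graph_over_def t)
  then have "ifs_map N x y S q w (a, b, f (a, b)) \<in> graph_over D f"
    using assms(1) by blast
  then show "letter_map N x y w t \<in> D"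
    and "f (letter_map N x y w t)
           = S (letter_map N x y w t) * f t + q (letter_map N x y w t)"
    by (auto simp: graph_over_def ifs_map_def t)
qed

section \<open>Oscillation under a change of scale\<close>

lemma diff_le_osc:
  assumes "\<And>s. s \<in> E \<Longrightarrow> \<bar>\<phi> s\<bar> \<le> M" and "s \<in> E" and "t \<in> E"
  shows "\<phi> s - \<phi> t \<le> osc \<phi> E"
  unfolding osc_def
proof (rule cSup_upper)
  show "\<phi> s - \<phi> t \<in> {\<phi> s - \<phi> t | s t. s \<in> E \<and> t \<in> E}"
    using assms(2,3) by blast
  have "\<phi> s - \<phi> t \<le> 2 * M" if "s \<in> E" "t \<in> E" for s t
    using assms(1)[OF that(1)] assms(1)[OF that(2)] by linarith
  then show "bdd_above {\<phi> s - \<phi> t | s t. s \<in> E \<and> t \<in> E}"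
    by (auto intro!: bdd_aboveI[of _ "2 * M"])
qed

lemma osc_le:
  assumes "E \<noteq> {}" and "\<And>s t. s \<in> E \<Longrightarrow> t \<in> E \<Longrightarrow> \<phi> s - \<phi> t \<le> B"
  shows "osc \<phi> E \<le> B"
  unfolding osc_def
proof (rule cSup_least)
  show "{\<phi> s - \<phi> t | s t. s \<in> E \<and> t \<in> E} \<noteq> {}"
    using assms(1) by blast
qed (use assms(2) in auto)

text \<open>
  Splitting the increment of \<open>S * f + q\<close> in this asymmetric way leaves \<open>S\<close> at a single point as the
  factor of the increment of \<open>f\<close>.
\<close>

lemma affine_increment:
  fixes S q f :: "'a \<Rightarrow> real" and L :: "'a \<Rightarrow> 'a"
  assumes "f (L s) = S (L s) * f s + q (L s)" and "f (L t) = S (L t) * f t + q (L t)"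
    and "\<bar>f t\<bar> \<le> M" and "\<bar>S (L s) - S (L t)\<bar> \<le> dS" and "\<bar>q (L s) - q (L t)\<bar> \<le> dq"
  shows "\<bar>(f (L s) - f (L t)) - S (L s) * (f s - f t)\<bar> \<le> dS * M + dq"
proof -
  have "(f (L s) - f (L t)) - S (L s) * (f s - f t)
          = (S (L s) - S (L t)) * f t + (q (L s) - q (L t))"
    by (simp add: assms(1,2) algebra_simps)
  moreover have "\<bar>(S (L s) - S (L t)) * f t\<bar> \<le> dS * M"
    unfolding abs_mult using assms(3,4) by (intro mult_mono) auto
  ultimately show ?thesis using assms(5) by linarith
qed

lemma osc_image_le:
  fixes S q f :: "'a \<Rightarrow> real" and L :: "'a \<Rightarrow> 'a"
  assumes ne: "E \<noteq> {}"
    and eq: "\<And>s. s \<in> E \<Longrightarrow> f (L s) = S (L s) * f s + q (L s)"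
    and bound: "\<And>s. s \<in> E \<Longrightarrow> \<bar>f s\<bar> \<le> M"
    and S: "\<And>s t. s \<in> E \<Longrightarrow> t \<in> E \<Longrightarrow> \<bar>S (L s) - S (L t)\<bar> \<le> dS"
    and q: "\<And>s t. s \<in> E \<Longrightarrow> t \<in> E \<Longrightarrow> \<bar>q (L s) - q (L t)\<bar> \<le> dq"
    and b: "\<And>s. s \<in> E \<Longrightarrow> \<bar>S (L s)\<bar> \<le> b"
  shows "osc f (L ` E) \<le> b * osc f E + (dS * M + dq)"
proof (rule osc_le)
  show "L ` E \<noteq> {}" using ne by simp
  fix s' t' assume "s' \<in> L ` E" "t' \<in> L ` E"
  then obtain s t where st: "s \<in> E" "t \<in> E" and eqs: "s' = L s" "t' = L t"
    by blast
  have inc: "\<bar>(f (L s) - f (L t)) - S (L s) * (f s - f t)\<bar> \<le> dS * M + dq"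
    using st by (intro affine_increment[where q = q] eq bound S q)
  have "\<bar>f s - f t\<bar> \<le> osc f E"
    using diff_le_osc[of E f M s t, OF bound] diff_le_osc[of E f M t s, OF bound] st by auto
  then have "\<bar>S (L s) * (f s - f t)\<bar> \<le> b * osc f E"
    unfolding abs_mult using b[OF st(1)] by (intro mult_mono) auto
  then show "f s' - f t' \<le> b * osc f E + (dS * M + dq)"
    using inc unfolding eqs by linarith
qed

lemma osc_image_ge:
  fixes S q f :: "'a \<Rightarrow> real" and L :: "'a \<Rightarrow> 'a"
  assumes ne: "E \<noteq> {}"
    and eq: "\<And>s. s \<in> E \<Longrightarrow> f (L s) = S (L s) * f s + q (L s)"
    and bound: "\<And>s. s \<in> E \<Longrightarrow> \<bar>f s\<bar> \<le> M"
    and bound': "\<And>s. s \<in> E \<Longrightarrow> \<bar>f (L s)\<bar> \<le> M"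
    and S: "\<And>s t. s \<in> E \<Longrightarrow> t \<in> E \<Longrightarrow> \<bar>S (L s) - S (L t)\<bar> \<le> dS"
    and q: "\<And>s t. s \<in> E \<Longrightarrow> t \<in> E \<Longrightarrow> \<bar>q (L s) - q (L t)\<bar> \<le> dq"
    and c: "\<And>s. s \<in> E \<Longrightarrow> c \<le> \<bar>S (L s)\<bar>" and c0: "0 \<le> c"
  shows "c * osc f E - (dS * M + dq) \<le> osc f (L ` E)"
proof -
  let ?O = "osc f (L ` E)" and ?e = "dS * M + dq"
  have O: "f (L s) - f (L t) \<le> ?O" if "s \<in> E" "t \<in> E" for s t
    using that bound' by (intro diff_le_osc[where M = M]) auto
  have inc: "\<bar>(f (L s) - f (L t)) - S (L s) * (f s - f t)\<bar> \<le> ?e" if "s \<in> E" "t \<in> E" for s t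
    using that by (intro affine_increment[where q = q] eq bound S q)
  have nonneg: "0 \<le> ?O + ?e"
    using ne O inc by fastforce
  have step: "c * (f s - f t) \<le> ?O + ?e" if st: "s \<in> E" "t \<in> E" for s t
  proof (cases "f t \<le> f s")
    case True
    then have "c * (f s - f t) \<le> \<bar>S (L s)\<bar> * (f s - f t)"
      using c[OF st(1)] by (intro mult_right_mono) auto
    \<comment> \<open>A negative value of \<open>S\<close> reverses the increment, and then \<open>f (L t) - f (L s)\<close> is the large
      one; the oscillation does not distinguish the two.\<close>
    also have "\<dots> = \<bar>S (L s) * (f s - f t)\<bar>"
      using True by (simp add: abs_mult)
    also have "\<dots> \<le> ?O + ?e"
      using inc[OF st] O[OF st] O[OF st(2,1)] by linarith
    finally show ?thesis .
  next
    case False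
    then have "c * (f s - f t) \<le> 0"
      using c0 by (intro mult_nonneg_nonpos) auto
    then show ?thesis using nonneg by linarith
  qed
  have "c * osc f E \<le> ?O + ?e"
  proof (cases "c = 0")
    case False
    then have "0 < c" using c0 by simp
    then have "osc f E \<le> (?O + ?e) / c"
      using step by (intro osc_le[OF ne]) (simp add: pos_le_divide_eq mult.commute)
    then show ?thesis
      using \<open>0 < c\<close> by (simp add: pos_le_divide_eq mult.commute)
  qed (use nonneg in simp)
  then show ?thesis by simp
qed

section \<open>The oscillation inequality\<close>

theorem lemma3p3:
  fixes N :: nat
    and x y :: "nat \<Rightarrow> real"
    and z :: "nat \<Rightarrow> nat \<Rightarrow> real"
    and g h S q f :: "real \<times> real \<Rightarrow> real"
    and lam_S lam_q :: real
  assumes N: "N \<ge> 2"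
    and x_mono: "strict_mono_on {0..N} x"
    and y_mono: "strict_mono_on {0..N} y"
    and x_step: "\<And>i. i \<in> {1..N} \<Longrightarrow> x i - x (i - 1) = (x N - x 0) / real N"
    and y_step: "\<And>i. i \<in> {1..N} \<Longrightarrow> y i - y (i - 1) = (y N - y 0) / real N"
    and square: "x N - x 0 = y N - y 0"
    and g_cont: "continuous_on (rect N x y) g"
    and h_cont: "continuous_on (rect N x y) h"
    and S_cont: "continuous_on (rect N x y) S"
    and g_interp: "\<And>i j. i \<in> {0, N} \<Longrightarrow> j \<in> {0, N} \<Longrightarrow> g (x i, y j) = z i j"
    and h_interp: "\<And>i j. i \<in> {0..N} \<Longrightarrow> j \<in> {0..N} \<Longrightarrow> h (x i, y j) = z i j"
    and S_less: "\<And>t. t \<in> rect N x y \<Longrightarrow> \<bar>S t\<bar> < 1"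
    and q_eq: "\<And>w t. w \<in> letters N \<Longrightarrow> t \<in> cell x y w \<Longrightarrow>
                 q t = h t - S t * g (inv_into (rect N x y) (letter_map N x y w) t)"
    and f_cont: "continuous_on (rect N x y) f"
    and f_interp: "\<And>i j. i \<in> {0..N} \<Longrightarrow> j \<in> {0..N} \<Longrightarrow> f (x i, y j) = z i j"
    and f_graph: "graph_over (rect N x y) f =
                    (\<Union>w\<in>letters N. ifs_map N x y S q w ` graph_over (rect N x y) f)"
    and lS_pos: "lam_S > 0" and lq_pos: "lam_q > 0"
    and S_lip: "lam_S-lipschitz_on (rect N x y) S"
    and q_lip: "lam_q-lipschitz_on (rect N x y) q"
  shows "\<forall>n\<ge>1. \<forall>k\<ge>1. \<forall>i\<in>words N n.
           mat_vec (words N n) (lower_mat N x y S n) (osc_vec N x y f n (k - 1)) i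
               - real N ^ k * err_vec N x y f lam_S lam_q n i
             \<le> osc_vec N x y f n k i
         \<and> osc_vec N x y f n k i
             \<le> mat_vec (words N n) (upper_mat N x y S n) (osc_vec N x y f n (k - 1)) i
               + real N ^ k * err_vec N x y f lam_S lam_q n i"
proof (intro allI impI ballI)
  fix n k :: nat and i
  assume n: "1 \<le> n" and k: "1 \<le> k" and i: "i \<in> words N n"
  let ?D = "rect N x y"
  define M where "M = sup_abs f ?D"
  define K where "K = 2 * lam_S * M + lam_q"
  define l where "l = x N - x 0"
  define d where "d = sqrt 2 * l / real N ^ (n + k)"
  define e where "e = K * d"
  obtain k' where k': "k = Suc k'"
    using k by (cases k) auto
  obtain a p where ap: "i = a # p" "a \<in> letters N" "set p \<subseteq> letters N"
    using n i by (cases i) (auto simp: words_def)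
  have len: "length i = n" and i_letters: "set i \<subseteq> letters N"
    using i by (auto simp: words_def)
  have x_lt: "x 0 < x N" and y_lt: "y 0 < y N"
    using N x_mono y_mono by (auto simp: strict_mono_on_def)

  have "x 0 \<le> x N" "y 0 \<le> y N" using x_lt y_lt by auto
  then have D_ne: "?D \<noteq> {}" by (auto simp: rect_def)
  have "compact ?D"
    by (simp add: rect_def compact_Times)
  then have "compact ((\<lambda>t. \<bar>f t\<bar>) ` ?D)"
    by (intro compact_continuous_image continuous_intros f_cont)
  then have "bdd_above ((\<lambda>t. \<bar>f t\<bar>) ` ?D)"
    by (intro bounded_imp_bdd_above compact_imp_bounded)
  then have f_le: "\<bar>f t\<bar> \<le> M" if "t \<in> ?D" for t
    unfolding M_def sup_abs_def using that by (intro cSUP_upper)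
  then have M_nonneg: "0 \<le> M"
    using D_ne by fastforce

  have inv: "ifs_map N x y S q w ` graph_over ?D f \<subseteq> graph_over ?D f" if "w \<in> letters N" for w
    using f_graph that by blast
  have maps: "letter_map N x y w ` ?D \<subseteq> ?D" if "w \<in> letters N" for w
    using graph_invariant_eq(1)[OF inv[OF that]] by blast
  have cell_D: "word_cell N x y v \<subseteq> ?D" if "set v \<subseteq> letters N" for v
    using word_cell_subset_rect[OF maps that] .

  \<comment> \<open>The letter \<open>c\<close> and the word \<open>w\<close> extend \<open>i\<close>; the extension is \<open>a # v\<close> for \<open>v = p @ c # w\<close>.\<close>
  have one: "inf_abs S (word_cell N x y (i @ [c])) * osc f (word_cell N x y ((tl i @ [c]) @ w)) - e
               \<le> osc f (word_cell N x y ((i @ [c]) @ w))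
           \<and> osc f (word_cell N x y ((i @ [c]) @ w))
               \<le> sup_abs S (word_cell N x y (i @ [c])) * osc f (word_cell N x y ((tl i @ [c]) @ w)) + e"
    if c: "c \<in> letters N" and w: "w \<in> words N k'" for c w
  proof -
    let ?L = "letter_map N x y a"
    let ?E = "word_cell N x y ((tl i @ [c]) @ w)" and ?C = "word_cell N x y (i @ [c])"
    have w': "set w \<subseteq> letters N" "length w = k'"
      using w by (auto simp: words_def)
    have v: "set ((tl i @ [c]) @ w) \<subseteq> letters N"
      using ap c w' by auto
    have image: "word_cell N x y ((i @ [c]) @ w) = ?L ` ?E"
      by (simp add: ap word_cell_Cons)
    have E_D: "?E \<subseteq> ?D"
      using v by (rule cell_D)
    have LE_C: "?L ` ?E \<subseteq> ?C"
      unfolding image[symmetric] by (rule word_cell_append_subset[OF maps w'(1)])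
    have C_D: "?C \<subseteq> ?D"
      using i_letters c by (intro cell_D) auto
    have E_ne: "?E \<noteq> {}"
      using D_ne by (simp add: word_cell_def)
    have d_bound: "dist s' t' \<le> d" if st: "s' \<in> ?L ` ?E" "t' \<in> ?L ` ?E" for s' t'
    proof -
      obtain s where s: "s \<in> ?D" "s' = word_map N x y ((i @ [c]) @ w) s"
        using st(1) unfolding image[symmetric] unfolding word_cell_def by (rule imageE)
      obtain t where t: "t \<in> ?D" "t' = word_map N x y ((i @ [c]) @ w) t"
        using st(2) unfolding image[symmetric] unfolding word_cell_def by (rule imageE)
      have ext: "set ((i @ [c]) @ w) \<subseteq> letters N"
        using i_letters c w' by auto
      have "dist s' t' = dist s t / real N ^ length ((i @ [c]) @ w)"
        unfolding s(2) t(2)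
        by (rule dist_word_map[OF dist_letter_map[OF x_lt y_lt x_step y_step] ext])
      also have "length ((i @ [c]) @ w) = n + k"
        using len w' by (simp add: k')
      also have "dist s t / real N ^ (n + k) \<le> d"
        unfolding d_def l_def
        by (intro divide_right_mono dist_rect_le[OF square s(1) t(1)]) simp
      finally show ?thesis .
    qed
    have eq: "f (?L s) = S (?L s) * f s + q (?L s)" if "s \<in> ?E" for s
      using graph_invariant_eq(2)[OF inv[OF ap(2)]] that E_D by blast
    have f_E: "\<bar>f s\<bar> \<le> M" and f_LE: "\<bar>f (?L s)\<bar> \<le> M" if "s \<in> ?E" for s
      using that E_D LE_C C_D by (auto intro!: f_le)
    have S_E: "\<bar>S (?L s) - S (?L t)\<bar> \<le> lam_S * d"
      and q_E: "\<bar>q (?L s) - q (?L t)\<bar> \<le> lam_q * d" if st: "s \<in> ?E" "t \<in> ?E" for s t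
    proof -
      have D: "?L s \<in> ?D" "?L t \<in> ?D"
        using st LE_C C_D by auto
      have d: "dist (?L s) (?L t) \<le> d"
        using st by (intro d_bound) auto
      show "\<bar>S (?L s) - S (?L t)\<bar> \<le> lam_S * d"
        using order_trans[OF lipschitz_onD[OF S_lip D] mult_left_mono[OF d]] lS_pos
        by (simp add: dist_real_def)
      show "\<bar>q (?L s) - q (?L t)\<bar> \<le> lam_q * d"
        using order_trans[OF lipschitz_onD[OF q_lip D] mult_left_mono[OF d]] lq_pos
        by (simp add: dist_real_def)
    qed
    have "\<bar>S t\<bar> \<le> 1" if "t \<in> ?C" for t
      using S_less[of t] C_D that by auto
    then have S_bdd: "bdd_above ((\<lambda>t. \<bar>S t\<bar>) ` ?C)" "bdd_below ((\<lambda>t. \<bar>S t\<bar>) ` ?C)"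
      by (auto intro!: bdd_aboveI2 bdd_belowI2[where m = 0])
    have sup: "\<bar>S (?L s)\<bar> \<le> sup_abs S ?C" and inf: "inf_abs S ?C \<le> \<bar>S (?L s)\<bar>"
      if "s \<in> ?E" for s
      using that LE_C S_bdd by (auto simp: sup_abs_def inf_abs_def intro!: cSUP_upper cINF_lower)
    have inf_nonneg: "0 \<le> inf_abs S ?C"
      unfolding inf_abs_def using D_ne by (intro cINF_greatest) (auto simp: word_cell_def)
    have "0 \<le> d"
      using x_lt by (simp add: d_def l_def)
    then have "0 \<le> lam_S * d * M"
      using lS_pos M_nonneg by simp
    then have "lam_S * d * M + lam_q * d \<le> e"
      by (simp add: e_def K_def algebra_simps)
    then show ?thesis
      unfolding image
      using osc_image_le[where L = ?L and S = S and q = q and f = f,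
          OF E_ne eq f_E S_E q_E sup]
        osc_image_ge[where L = ?L and S = S and q = q and f = f,
          OF E_ne eq f_E f_LE S_E q_E inf inf_nonneg]
      by linarith
  qed

  let ?card = "real (card (letters N)) * real (card (words N k'))"
  have "card (letters N) = N ^ 2"
    by (simp add: letters_def power2_eq_square)
  then have card: "?card = real N ^ (2 * k)"
    by (simp add: card_words k' power_add power2_eq_square)
  have "real N ^ (2 * k) / real N ^ (n + k) = real N ^ k / real N ^ n"
    using N by (simp add: power_add mult_2)
  moreover have "real N ^ (2 * k) * e = K * sqrt 2 * l * (real N ^ (2 * k) / real N ^ (n + k))"
    by (simp add: e_def d_def)
  ultimately have "real N ^ (2 * k) * e = real N ^ k * (sqrt 2 * K / real N ^ n * l)"
    by (simp only:) simp
  then have err: "?card * e = real N ^ k * err_vec N x y f lam_S lam_q n i"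
    using i unfolding card by (simp add: err_vec_def K_def M_def l_def)
  have vec: "osc_vec N x y f n k i = (\<Sum>c\<in>letters N. osc_sum N x y f k' (i @ [c]))"
    using i by (simp add: osc_vec_def k' osc_sum_Suc)

  have "mat_vec (words N n) (lower_mat N x y S n) (osc_vec N x y f n (k - 1)) i - ?card * e
          = (\<Sum>c\<in>letters N. \<Sum>w\<in>words N k'. inf_abs S (word_cell N x y (i @ [c]))
                * osc f (word_cell N x y ((tl i @ [c]) @ w)) - e)"
    unfolding lower_mat_def mat_vec_shift_mat[OF n i]
    by (simp add: k' osc_sum_def sum_subtractf sum_distrib_left)
  also have "\<dots> \<le> osc_vec N x y f n k i"
    unfolding vec osc_sum_def using one by (intro sum_mono) blast
  finally have lower: "mat_vec (words N n) (lower_mat N x y S n) (osc_vec N x y f n (k - 1)) i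
      - ?card * e \<le> osc_vec N x y f n k i" .

  have "osc_vec N x y f n k i
          \<le> (\<Sum>c\<in>letters N. \<Sum>w\<in>words N k'. sup_abs S (word_cell N x y (i @ [c]))
                * osc f (word_cell N x y ((tl i @ [c]) @ w)) + e)"
    unfolding vec osc_sum_def using one by (intro sum_mono) blast
  also have "\<dots> = mat_vec (words N n) (upper_mat N x y S n) (osc_vec N x y f n (k - 1)) i
      + ?card * e"
    unfolding upper_mat_def mat_vec_shift_mat[OF n i]
    by (simp add: k' osc_sum_def sum.distrib sum_distrib_left)
  finally show "mat_vec (words N n) (lower_mat N x y S n) (osc_vec N x y f n (k - 1)) i
               - real N ^ k * err_vec N x y f lam_S lam_q n i
             \<le> osc_vec N x y f n k i
         \<and> osc_vec N x y f n k i
             \<le> mat_vec (words N n) (upper_mat N x y S n) (osc_vec N x y f n (k - 1)) i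
               + real N ^ k * err_vec N x y f lam_S lam_q n i"
    using lower unfolding err by blast
qed

end
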